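(* For every $n\ge 3$ and every integer $m$ with $1\le m<n-1$, there exist closed connected sets in $\mathbb{R}^n$ that are weakly $m$-convex but not $m$-convex.
   Context: Let $n\ge 2$ and $1\le m<n$. An $m$-dimensional plane is an $m$-dimensional affine subspace of $\mathbb{R}^n$. A set $E\subset\mathbb{R}^n$ is $m$-convex with respect to a point $x\in\mathbb{R}^n\setminus E$ if there exists an $m$-dimensional plane $L$ with $x\in L$ and $L\cap E=\varnothing$. A set $E$ is $m$-convex if it is $m$-convex with respect to every point $x\in\mathbb{R}^n\setminus E$. An open set $G\subset\mathbb{R}^n$ is weakly $m$-convex if it is $m$-convex with respect to every point $x\in\partial G$. A set $A$ is approximated from the outside by a family of open sets $A_k$, $k=1,2,\ldots$, if $\overline{A_{k+1}}\subset A_k$ for all $k$ and $A=\bigcap_k A_k$. A closed set $E\subset\mathbb{R}^n$ is weakly $m$-convex if it can be approximated from the outside by a family of open weakly $m$-convex sets $A_k$, $k=1,2,\ldots$. *)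

theory Defs
  imports "HOL-Analysis.Analysis"
begin

definition plane :: "nat \<Rightarrow> 'a::euclidean_space set \<Rightarrow> bool" where
  "plane m L \<longleftrightarrow> affine L \<and> aff_dim L = int m"

(* The requirement that x lies outside E is implied: x is in L and L misses E. *)
definition m_convex_at :: "nat \<Rightarrow> 'a::euclidean_space set \<Rightarrow> 'a \<Rightarrow> bool" where
  "m_convex_at m E x \<longleftrightarrow> (\<exists>L. plane m L \<and> x \<in> L \<and> L \<inter> E = {})"

definition m_convex :: "nat \<Rightarrow> 'a::euclidean_space set \<Rightarrow> bool" where
  "m_convex m E \<longleftrightarrow> (\<forall>x. x \<notin> E \<longrightarrow> m_convex_at m E x)"

definition weakly_m_convex_open :: "nat \<Rightarrow> 'a::euclidean_space set \<Rightarrow> bool" where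
  "weakly_m_convex_open m G \<longleftrightarrow> open G \<and> (\<forall>x\<in>frontier G. m_convex_at m G x)"

(* Only the members A k with k >= 1 matter; A 0 is unconstrained. *)
definition approximated_from_outside ::
    "'a::euclidean_space set \<Rightarrow> (nat \<Rightarrow> 'a set) \<Rightarrow> bool" where
  "approximated_from_outside E A \<longleftrightarrow>
     (\<forall>k\<ge>1. open (A k)) \<and>
     (\<forall>k\<ge>1. closure (A (Suc k)) \<subseteq> A k) \<and>
     E = (\<Inter>k\<in>{1..}. A k)"

definition weakly_m_convex_closed :: "nat \<Rightarrow> 'a::euclidean_space set \<Rightarrow> bool" where
  "weakly_m_convex_closed m E \<longleftrightarrow>
     closed E \<and>
     (\<exists>A. approximated_from_outside E A \<and> (\<forall>k\<ge>1. weakly_m_convex_open m (A k)))"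

end

theory Submission
  imports Defs
begin

(* Let s be a cyclic shift of the coordinates.  The complement of E is the open cube |x_i| < 1
   (all i) together with the slabs 0 < |x_i| < 1, |x_(s i)| < 1.  A slab is a union of planes of
   codimension 2, and shrinking cube and slabs a little yields closed sets whose boundary points
   all lie in the slab part; their complements are the approximating open sets.  Every line through
   the origin is eventually in E, because far out each coordinate is 0 or at least 1 in absolute
   value.  Finally, coordinate i can be moved freely as long as |x_(s i)| >= 1, and since s
   is a cycle, such moves connect every point of E to (1, ..., 1). *)

section \<open>Finite quantifiers, coordinate planes and the cyclic shift\<close>

lemma open_Collect_all_finite:
  fixes P :: "'i::finite \<Rightarrow> 'a::topological_space \<Rightarrow> bool"
  assumes "\<And>i. open {x. P i x}" shows "open {x. \<forall>i. P i x}"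
  using open_INT[of UNIV "\<lambda>i. {x. P i x}"] assms by (simp add: Collect_all_eq)

lemma closed_Collect_ex_finite:
  fixes P :: "'i::finite \<Rightarrow> 'a::topological_space \<Rightarrow> bool"
  assumes "\<And>i. closed {x. P i x}" shows "closed {x. \<exists>i. P i x}"
  using closed_UN[of UNIV "\<lambda>i. {x. P i x}"] assms by (simp add: Collect_ex_eq)

text \<open>Take \<open>m\<close> of the basis vectors in directions other than \<open>i\<close> and
  \<open>j\<close>, and translate their span to \<open>x\<close>. At least
  \<open>CARD('n) - 2\<close> such directions exist, which is why \<open>m\<close> must not exceed
  this number. These planes later avoid sets that are cut out by conditions on two
  coordinates.\<close>

lemma ex_coordinate_plane:
  fixes x :: "real ^ 'n::finite"
  assumes "m \<le> CARD('n) - 2"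
  obtains L where "plane m L" "x \<in> L" "\<And>y. y \<in> L \<Longrightarrow> y $ i = x $ i \<and> y $ j = x $ j"
proof -
  have "CARD('n) - card {i, j} \<le> card (UNIV - {i, j})"
    by (rule diff_card_le_card_Diff) simp
  then have "m \<le> card (- {i, j})"
    using assms card_insert_le_m1[of 2 "{j}" i] by (simp add: Compl_eq_Diff_UNIV)
  then obtain I where I: "I \<subseteq> - {i, j}" "card I = m"
    by (meson obtain_subset_with_card_n)
  define B where "B = (\<lambda>l. axis l (1::real)) ` I"
  have "inj_on (\<lambda>l. axis l (1::real) :: real ^ 'n) I"
    by (auto simp: inj_on_def axis_eq_axis)
  then have cardB: "card B = m" using I by (simp add: B_def card_image)
  have "B \<subseteq> Basis" by (auto simp: B_def Basis_vec_def)
  then have "independent B" using independent_Basis independent_mono by blast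
  then have dimB: "dim (span B) = m" using cardB by (simp add: dim_eq_card_independent)
  have "B \<subseteq> {v. v $ i = 0 \<and> v $ j = 0}" using I by (auto simp: B_def axis_def)
  then have spanB: "span B \<subseteq> {v. v $ i = 0 \<and> v $ j = 0}"
    by (rule span_minimal) (auto simp: subspace_def)
  show thesis
  proof
    show "plane m ((+) x ` span B)"
      using affine_translation[of "span B" x] subspace_imp_affine[OF subspace_span, of B]
      by (simp add: plane_def aff_dim_translation_eq aff_dim_subspace[OF subspace_span] dimB
          del: dim_span)
    show "x \<in> (+) x ` span B"
      using span_zero[of B] by force
    show "y $ i = x $ i \<and> y $ j = x $ j" if "y \<in> (+) x ` span B" for y
      using that spanB by auto
  qed
qed

lemma connected_component_segment:
  fixes x y :: "'a::real_normed_vector"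
  assumes "closed_segment x y \<subseteq> S" shows "connected_component S x y"
  unfolding connected_component_def
  by (intro exI[of _ "closed_segment x y"]) (simp add: assms connected_segment)

text \<open>That \<open>s\<close> is a single cycle is stated as an induction principle: steps
  backwards along \<open>s\<close> from any index reach every index. The witness numbers the indices
  through \<open>h\<close> and takes the successor modulo \<open>n\<close>.\<close>

lemma ex_cyclic_shift:
  "\<exists>s :: 'n::finite \<Rightarrow> 'n. \<forall>P. P \<noteq> {} \<longrightarrow> (\<forall>i. s i \<in> P \<longrightarrow> i \<in> P) \<longrightarrow> P = UNIV"
proof -
  define n where "n = CARD('n)"
  have n: "0 < n" by (simp add: n_def)
  obtain h where h: "bij_betw h {0..<n} (UNIV :: 'n set)"
    using ex_bij_betw_nat_finite[OF finite_class.finite_UNIV] unfolding n_def by metis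
  define g where "g = the_inv_into {0..<n} h"
  have g: "g (h k) = k" if "k < n" for k
    using h that by (simp add: g_def bij_betw_def the_inv_into_f_f)
  have ex: "\<exists>k<n. i = h k" for i
  proof -
    have "i \<in> h ` {0..<n}" using h by (simp add: bij_betw_def)
    then show ?thesis by auto
  qed
  define s where "s i = h (Suc (g i) mod n)" for i
  have "P = UNIV" if "P \<noteq> {}" and P: "\<And>i. s i \<in> P \<Longrightarrow> i \<in> P" for P
  proof -
    have pred: "h k \<in> P" if "h (Suc k mod n) \<in> P" "k < n" for k
      using P[of "h k"] that by (simp add: s_def g)
    have down: "h j \<in> P" if "j \<le> k" "h k \<in> P" "k < n" for j k
      using that
    proof (induction rule: inc_induct)
      case (step l)
      then show ?case using pred[of l] by simp
    qed
    obtain i where "i \<in> P" using \<open>P \<noteq> {}\<close> by blast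
    then obtain k where "k < n" "h k \<in> P" using ex[of i] by auto
    then have "h 0 \<in> P" using down by blast
    \<comment> \<open>Here the cycle wraps around: the successor of \<open>n - 1\<close> modulo
      \<open>n\<close> is 0. Descending from \<open>n - 1\<close> then covers all indices.\<close>
    then have "h (n - 1) \<in> P" using pred[of "n - 1"] n by simp
    then have "h j \<in> P" if "j < n" for j using down[of j "n - 1"] that by simp
    then have "i \<in> P" for i using ex[of i] by auto
    then show "P = UNIV" by auto
  qed
  then show ?thesis by (intro exI[of _ s]) simp
qed

section \<open>The set, its neighbourhoods and weak convexity\<close>

context
  fixes s :: "'n::finite \<Rightarrow> 'n"
begin

definition slab_set :: "(real ^ 'n) set" where
  "slab_set = {x. (\<exists>i. 1 \<le> \<bar>x $ i\<bar>) \<and> (\<forall>i. x $ i = 0 \<or> 1 \<le> \<bar>x $ i\<bar> \<or> 1 \<le> \<bar>x $ s i\<bar>)}"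

text \<open>The thresholds 0 and 1 of \<open>slab_set\<close> are relaxed to \<open>e\<close> and
  \<open>1 - e\<close>, with strict inequalities to make the set open. The approximating sets are
  those with \<open>e = 1 / (k + 1)\<close>.\<close>

definition slab_nbhd :: "real \<Rightarrow> (real ^ 'n) set" where
  "slab_nbhd e = {x. (\<exists>i. 1 - e < \<bar>x $ i\<bar>) \<and>
     (\<forall>i. \<bar>x $ i\<bar> < e \<or> 1 - e < \<bar>x $ i\<bar> \<or> 1 - e < \<bar>x $ s i\<bar>)}"

text \<open>This closed set is a bound for the closure of \<open>slab_nbhd e\<close>, and it fits
  inside \<open>slab_nbhd d\<close> whenever \<open>e < d\<close>. Nestedness of the approximation
  follows without computing a closure.\<close>

definition slab_cnbhd :: "real \<Rightarrow> (real ^ 'n) set" where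
  "slab_cnbhd e = {x. (\<exists>i. 1 - e \<le> \<bar>x $ i\<bar>) \<and>
     (\<forall>i. \<bar>x $ i\<bar> \<le> e \<or> 1 - e \<le> \<bar>x $ i\<bar> \<or> 1 - e \<le> \<bar>x $ s i\<bar>)}"

lemma open_slab_nbhd: "open (slab_nbhd e)"
  unfolding slab_nbhd_def
  by (intro open_Collect_conj open_Collect_ex open_Collect_all_finite open_Collect_disj
      open_Collect_less continuous_intros)

lemma closed_slab_cnbhd: "closed (slab_cnbhd e)"
  unfolding slab_cnbhd_def
  by (intro closed_Collect_conj closed_Collect_ex_finite closed_Collect_all closed_Collect_disj
      closed_Collect_le continuous_intros)

lemma closed_slab_set: "closed (slab_set)"
  unfolding slab_set_def
  by (intro closed_Collect_conj closed_Collect_ex_finite closed_Collect_all closed_Collect_disj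
      closed_Collect_le closed_Collect_eq continuous_intros)

lemma closure_slab_nbhd: "closure (slab_nbhd e) \<subseteq> slab_cnbhd e"
proof (rule closure_minimal[OF _ closed_slab_cnbhd], rule subsetI)
  fix x assume "x \<in> slab_nbhd e"
  then show "x \<in> slab_cnbhd e"
    unfolding slab_nbhd_def slab_cnbhd_def mem_Collect_eq by (meson less_imp_le)
qed

lemma slab_cnbhd_subset_nbhd:
  assumes "e < d" shows "slab_cnbhd e \<subseteq> slab_nbhd d"
proof
  fix x assume x: "x \<in> slab_cnbhd e"
  have 1: "1 - d < \<bar>x $ i\<bar>" if "1 - e \<le> \<bar>x $ i\<bar>" for i using that assms by linarith
  have 2: "\<bar>x $ i\<bar> < d" if "\<bar>x $ i\<bar> \<le> e" for i using that assms by linarith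
  show "x \<in> slab_nbhd d"
    using x 1 2 unfolding slab_cnbhd_def slab_nbhd_def by blast
qed

text \<open>A boundary point violates the condition of some slab, and this violation involves only
  the coordinates \<open>i\<close> and \<open>s i\<close>. A plane through the point on which both
  are constant therefore misses the whole set.\<close>

lemma weakly_m_convex_open_slab_nbhd:
  assumes "m \<le> CARD('n) - 2" "e \<le> 1/2"
  shows "weakly_m_convex_open m (slab_nbhd e :: (real ^ 'n) set)"
  unfolding weakly_m_convex_open_def
proof (intro conjI ballI open_slab_nbhd)
  fix x :: "real ^ 'n" assume "x \<in> frontier (slab_nbhd e)"
  then have x: "x \<in> slab_cnbhd e" "x \<notin> slab_nbhd e"
    using closure_slab_nbhd[of e] interior_open[OF open_slab_nbhd[of e]]
    by (auto simp: frontier_def)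
  have "\<exists>i. e \<le> \<bar>x $ i\<bar> \<and> \<bar>x $ i\<bar> \<le> 1 - e \<and> \<bar>x $ s i\<bar> \<le> 1 - e"
  proof (cases "\<exists>i. 1 - e < \<bar>x $ i\<bar>")
    case True
    then show ?thesis using x(2) unfolding slab_nbhd_def by (auto simp: not_less)
  next
    case False
    \<comment> \<open>No coordinate exceeds \<open>1 - e\<close> in absolute value, but one attains
      it because the point lies in \<open>slab_cnbhd e\<close>. As \<open>e \<le> 1/2\<close>, that
      value is at least \<open>e\<close>, so the point also lies in a closed slab of the
      complement.\<close>
    moreover obtain i where "1 - e \<le> \<bar>x $ i\<bar>" using x(1) unfolding slab_cnbhd_def by auto
    ultimately have "e \<le> \<bar>x $ i\<bar> \<and> \<bar>x $ i\<bar> \<le> 1 - e \<and> \<bar>x $ s i\<bar> \<le> 1 - e"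
      using assms(2) by (auto simp: not_less)
    then show ?thesis by blast
  qed
  then obtain i where i: "e \<le> \<bar>x $ i\<bar>" "\<bar>x $ i\<bar> \<le> 1 - e" "\<bar>x $ s i\<bar> \<le> 1 - e" by blast
  obtain L where L: "plane m L" "x \<in> L" "\<And>y. y \<in> L \<Longrightarrow> y $ i = x $ i \<and> y $ s i = x $ s i"
    using ex_coordinate_plane[OF assms(1)] by blast
  have "y \<notin> slab_nbhd e" if "y \<in> L" for y
  proof -
    have "\<not> (\<bar>y $ i\<bar> < e \<or> 1 - e < \<bar>y $ i\<bar> \<or> 1 - e < \<bar>y $ s i\<bar>)"
      using L(3)[OF that] i by (simp add: not_less)
    then show ?thesis unfolding slab_nbhd_def by blast
  qed
  then show "m_convex_at m (slab_nbhd e) x"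
    using L(1,2) unfolding m_convex_at_def by blast
qed

lemma slab_set_eq_INT: "slab_set = (\<Inter>k\<in>{1..}. slab_nbhd (1 / (real k + 1)))"
proof (intro equalityI subsetI)
  fix x assume x: "x \<in> slab_set"
  show "x \<in> (\<Inter>k\<in>{1..}. slab_nbhd (1 / (real k + 1)))"
  proof
    fix k :: nat
    have e: "0 < 1 / (real k + 1)" by simp
    have 1: "1 - 1 / (real k + 1) < \<bar>x $ i\<bar>" if "1 \<le> \<bar>x $ i\<bar>" for i
      using that e by linarith
    have 2: "\<bar>x $ i\<bar> < 1 / (real k + 1)" if "x $ i = 0" for i
      using that e by simp
    show "x \<in> slab_nbhd (1 / (real k + 1))"
      using x 1 2 unfolding slab_set_def slab_nbhd_def by blast
  qed
next
  fix x assume x: "x \<in> (\<Inter>k\<in>{1..}. slab_nbhd (1 / (real k + 1)))"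
  have lim: "(\<lambda>k. 1 / (real k + 1)) \<longlonglongrightarrow> 0"
    using LIMSEQ_inverse_real_of_nat by (simp add: inverse_eq_divide add.commute)
  \<comment> \<open>The bound \<open>1 - 1 / (k + 1)\<close> tends to 1, so it eventually lies above
    any \<open>c < 1\<close>. With finitely many coordinates, one \<open>k\<close> then serves all
    of them, and a point outside \<open>slab_set\<close> is already outside some
    neighbourhood.\<close>
  have small: "\<forall>\<^sub>F k in sequentially. \<not> 1 - 1 / (real k + 1) < c" if "c < 1" for c :: real
    using order_tendstoD(2)[OF lim, of "1 - c"] that by (auto elim!: eventually_mono)
  have k1: "\<forall>\<^sub>F k in sequentially. 1 \<le> (k::nat)" by (rule eventually_ge_at_top)
  have "\<exists>i. 1 \<le> \<bar>x $ i\<bar>"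
  proof (rule ccontr)
    assume "\<not> ?thesis"
    then have "\<forall>\<^sub>F k in sequentially. \<forall>i. \<not> 1 - 1 / (real k + 1) < \<bar>x $ i\<bar>"
      by (intro eventually_all_finite small) (simp add: not_le)
    with k1 have "\<forall>\<^sub>F k in sequentially. 1 \<le> k \<and> (\<forall>i. \<not> 1 - 1 / (real k + 1) < \<bar>x $ i\<bar>)"
      by (rule eventually_conj)
    then obtain k where k: "1 \<le> k" "\<forall>i. \<not> 1 - 1 / (real k + 1) < \<bar>x $ i\<bar>"
      using eventually_happens sequentially_bot by blast
    then have "x \<notin> slab_nbhd (1 / (real k + 1))"
      unfolding slab_nbhd_def by blast
    then show False using x k(1) by auto
  qed
  moreover have "x $ i = 0 \<or> 1 \<le> \<bar>x $ i\<bar> \<or> 1 \<le> \<bar>x $ s i\<bar>" for i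
  proof (rule ccontr)
    assume "\<not> ?thesis"
    then have i: "0 < \<bar>x $ i\<bar>" "\<bar>x $ i\<bar> < 1" "\<bar>x $ s i\<bar> < 1" by auto
    have "\<forall>\<^sub>F k in sequentially. 1 \<le> k \<and> 1 / (real k + 1) < \<bar>x $ i\<bar> \<and>
        \<not> 1 - 1 / (real k + 1) < \<bar>x $ i\<bar> \<and> \<not> 1 - 1 / (real k + 1) < \<bar>x $ s i\<bar>"
      by (intro eventually_conj k1 small order_tendstoD(2)[OF lim] i)
    then obtain k where k: "1 \<le> k" "1 / (real k + 1) < \<bar>x $ i\<bar>"
        "\<not> 1 - 1 / (real k + 1) < \<bar>x $ i\<bar>" "\<not> 1 - 1 / (real k + 1) < \<bar>x $ s i\<bar>"
      using eventually_happens sequentially_bot by blast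
    then have "x \<notin> slab_nbhd (1 / (real k + 1))"
      unfolding slab_nbhd_def using less_asym by blast
    then show False using x k(1) by auto
  qed
  ultimately show "x \<in> slab_set" by (simp add: slab_set_def)
qed

lemma weakly_m_convex_closed_slab_set:
  assumes "m \<le> CARD('n) - 2"
  shows "weakly_m_convex_closed m (slab_set :: (real ^ 'n) set)"
  unfolding weakly_m_convex_closed_def
proof (intro conjI exI[of _ "\<lambda>k. slab_nbhd (1 / (real k + 1))"] allI impI closed_slab_set)
  have "closure (slab_nbhd (1 / (real (Suc k) + 1))) \<subseteq> slab_nbhd (1 / (real k + 1))" for k
    using closure_slab_nbhd slab_cnbhd_subset_nbhd
    by (rule subset_trans) (simp add: field_simps)
  then show "approximated_from_outside (slab_set) (\<lambda>k. slab_nbhd (1 / (real k + 1)))"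
    using slab_set_eq_INT unfolding approximated_from_outside_def by (auto simp: open_slab_nbhd)
  \<comment> \<open>Starting the family at \<open>k = 1\<close> is what gives
    \<open>e \<le> 1/2\<close>.\<close>
  show "weakly_m_convex_open m (slab_nbhd (1 / (real k + 1)) :: (real ^ 'n) set)"
    if "1 \<le> k" for k
    using that assms by (intro weakly_m_convex_open_slab_nbhd) (auto simp: field_simps)
qed

section \<open>Failure of convexity at the origin\<close>

lemma ex_scaleR_in_slab_set:
  assumes "y \<noteq> 0" shows "\<exists>t. t *\<^sub>R y \<in> slab_set"
proof -
  have "\<forall>\<^sub>F t in at_top. y $ i = 0 \<or> 1 \<le> \<bar>t * y $ i\<bar>" for i
  proof (cases "y $ i = 0")
    case False
    show ?thesis
      using eventually_ge_at_top[of "1 / \<bar>y $ i\<bar>"]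
    proof eventually_elim
      case (elim t)
      then have "1 \<le> t * \<bar>y $ i\<bar>" using False by (simp add: field_simps)
      also have "\<dots> \<le> \<bar>t * y $ i\<bar>" by (simp add: abs_mult mult_right_mono)
      finally show ?case ..
    qed
  qed simp
  then have "\<forall>\<^sub>F t in at_top. \<forall>i. y $ i = 0 \<or> 1 \<le> \<bar>t * y $ i\<bar>"
    by (rule eventually_all_finite)
  then obtain t where t: "\<forall>i. y $ i = 0 \<or> 1 \<le> \<bar>t * y $ i\<bar>"
    using eventually_happens trivial_limit_at_top_linorder by blast
  obtain i where "y $ i \<noteq> 0" using assms by (metis vec_eq_iff zero_index)
  then have "1 \<le> \<bar>(t *\<^sub>R y) $ i\<bar>" using t[rule_format, of i] by simp
  moreover have "(t *\<^sub>R y) $ j = 0 \<or> 1 \<le> \<bar>(t *\<^sub>R y) $ j\<bar>" for j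
    using t[rule_format, of j] by (elim disjE) simp_all
  ultimately have "t *\<^sub>R y \<in> slab_set"
    unfolding slab_set_def by blast
  then show ?thesis ..
qed

lemma not_m_convex_slab_set:
  assumes "1 \<le> m" shows "\<not> m_convex m (slab_set)"
proof
  assume "m_convex m (slab_set)"
  moreover have "0 \<notin> slab_set" by (simp add: slab_set_def)
  ultimately obtain L where L: "plane m L" "0 \<in> L" "L \<inter> slab_set = {}"
    unfolding m_convex_def m_convex_at_def by blast
  have "subspace L" using L by (simp add: plane_def subspace_affine)
  \<comment> \<open>A single point has affine dimension 0, while \<open>m\<close> is positive. So
    \<open>L\<close> contains a whole line through the origin.\<close>
  moreover have "L \<noteq> {0}" using L(1) assms by (auto simp: plane_def)
  then obtain y where "y \<in> L" "y \<noteq> 0" using L(2) by blast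
  ultimately show False
    using ex_scaleR_in_slab_set[of y] L(3) subspace_scale by blast
qed

section \<open>Connectedness\<close>

lemma connected_component_slab_set_one:
  fixes x :: "real ^ 'n"
  assumes s: "\<forall>P. P \<noteq> {} \<longrightarrow> (\<forall>i. s i \<in> P \<longrightarrow> i \<in> P) \<longrightarrow> P = UNIV"
    and fix_free: "\<And>i. s i \<noteq> i"
    and "\<And>i. x $ i = 0 \<or> 1 \<le> \<bar>x $ i\<bar>" "x \<noteq> 0"
  shows "connected_component (slab_set) x 1"
  using assms(3,4)
\<comment> \<open>The induction counts the coordinates different from 1; each round moves one of
  them to 1 along a segment.\<close>
proof (induction "card {i. x $ i \<noteq> 1}" arbitrary: x rule: less_induct)
  case less
  define M where "M = {i. 1 \<le> \<bar>x $ i\<bar>}"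
  have x: "x $ i = 0 \<or> i \<in> M" for i using less.prems(1) by (simp add: M_def)
  then have "M \<noteq> {}" using less.prems(2) by (auto simp: vec_eq_iff)
  \<comment> \<open>Since \<open>s i \<noteq> i\<close>, the large coordinate \<open>s i\<close>
    stays fixed while coordinate \<open>i\<close> varies. It keeps the point out of the cube and
    also secures the slab condition for \<open>i\<close>; every other coordinate is still 0 or
    large.\<close>
  have memI: "y \<in> slab_set" if "\<exists>i. s i \<in> M \<and> (\<forall>j. j \<noteq> i \<longrightarrow> y $ j = x $ j)" for y
  proof -
    obtain i where i: "s i \<in> M" "\<And>j. j \<noteq> i \<Longrightarrow> y $ j = x $ j" using \<open>\<exists>i. _\<close> by auto
    then have si: "1 \<le> \<bar>y $ s i\<bar>" using fix_free[of i] by (simp add: M_def)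
    moreover have "y $ j = 0 \<or> 1 \<le> \<bar>y $ j\<bar> \<or> 1 \<le> \<bar>y $ s j\<bar>" for j
      using i(2)[of j] less.prems(1)[of j] si by (cases "j = i") auto
    ultimately show ?thesis unfolding slab_set_def by blast
  qed
  show ?case
  proof (cases "x = 1")
    case True
    have "1 \<in> slab_set" by (simp add: slab_set_def)
    then show ?thesis using True by simp
  next
    case False
    \<comment> \<open>If all coordinates are large, any coordinate different from 1 may be moved.
      Otherwise \<open>M\<close> is not closed under backward steps, which yields a coordinate
      outside \<open>M\<close>, hence equal to 0, whose successor is large.\<close>
    have "\<exists>i. s i \<in> M \<and> x $ i \<noteq> 1"
    proof (cases "M = UNIV")
      case True
      then show ?thesis using False by (auto simp: vec_eq_iff)
    next
      case False
      then obtain i where "s i \<in> M" "i \<notin> M" using s[rule_format, of M] \<open>M \<noteq> {}\<close> by auto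
      then show ?thesis using x[of i] by auto
    qed
    then obtain i where i: "s i \<in> M" "x $ i \<noteq> 1" by blast
    define y :: "real ^ 'n" where "y = (\<chi> j. if j = i then 1 else x $ j)"
    have "closed_segment x y \<subseteq> slab_set"
    proof
      fix z assume "z \<in> closed_segment x y"
      then have "\<forall>j. j \<noteq> i \<longrightarrow> z $ j = x $ j"
        by (auto simp: in_segment y_def left_diff_distrib)
      then show "z \<in> slab_set" using i(1) memI by blast
    qed
    then have "connected_component (slab_set) x y"
      by (rule connected_component_segment)
    moreover have "connected_component (slab_set) y 1"
    proof (rule less.hyps)
      have "{j. y $ j \<noteq> 1} \<subset> {j. x $ j \<noteq> 1}"
        using i(2) by (auto simp: y_def)
      then show "card {j. y $ j \<noteq> 1} < card {j. x $ j \<noteq> 1}"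
        by (simp add: psubset_card_mono)
      show "y $ j = 0 \<or> 1 \<le> \<bar>y $ j\<bar>" for j
        using less.prems(1)[of j] by (simp add: y_def)
      have "y $ i = 1" by (simp add: y_def)
      then show "y \<noteq> 0" by auto
    qed
    ultimately show ?thesis by (rule connected_component_trans)
  qed
qed

lemma connected_slab_set:
  assumes s: "\<forall>P. P \<noteq> {} \<longrightarrow> (\<forall>i. s i \<in> P \<longrightarrow> i \<in> P) \<longrightarrow> P = UNIV"
    and fix_free: "\<And>i. s i \<noteq> i"
  shows "connected (slab_set)"
proof -
  have "connected_component (slab_set) x 1" if "x \<in> slab_set" for x
  proof -
    \<comment> \<open>Shrinking all small coordinates to 0 reduces to the previous lemma. This stays
      in the set: a small nonzero coordinate \<open>j\<close> has a large coordinate at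
      \<open>s j\<close>, which does not change along the segment.\<close>
    define y :: "real ^ 'n" where "y = (\<chi> j. if 1 \<le> \<bar>x $ j\<bar> then x $ j else 0)"
    obtain k where k: "1 \<le> \<bar>x $ k\<bar>" using \<open>x \<in> slab_set\<close> by (auto simp: slab_set_def)
    have "closed_segment x y \<subseteq> slab_set"
    proof
      fix z assume "z \<in> closed_segment x y"
      then obtain u where z: "z = (1 - u) *\<^sub>R x + u *\<^sub>R y" by (auto simp: in_segment)
      have big: "z $ j = x $ j" if "1 \<le> \<bar>x $ j\<bar>" for j
        using that by (simp add: z y_def algebra_simps)
      have zero: "z $ j = 0" if "x $ j = 0" for j
        using that by (simp add: z y_def)
      have "z $ j = 0 \<or> 1 \<le> \<bar>z $ j\<bar> \<or> 1 \<le> \<bar>z $ s j\<bar>" for j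
      proof -
        have "x $ j = 0 \<or> 1 \<le> \<bar>x $ j\<bar> \<or> 1 \<le> \<bar>x $ s j\<bar>"
          using \<open>x \<in> slab_set\<close> unfolding slab_set_def by blast
        then show ?thesis using zero[of j] big[of j] big[of "s j"] by metis
      qed
      moreover have "1 \<le> \<bar>z $ k\<bar>" using k big by simp
      ultimately show "z \<in> slab_set" unfolding slab_set_def by blast
    qed
    then have "connected_component (slab_set) x y"
      by (rule connected_component_segment)
    moreover have "connected_component (slab_set) y 1"
    proof (rule connected_component_slab_set_one[OF s fix_free])
      have "y $ k \<noteq> 0" using k by (auto simp: y_def)
      then show "y \<noteq> 0" by auto
    qed (auto simp: y_def)
    ultimately show ?thesis by (rule connected_component_trans)
  qed
  then show ?thesis
    unfolding connected_iff_connected_component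
    by (meson connected_component_sym connected_component_trans)
qed

end

theorem theorem4:
  fixes m :: nat
  assumes "CARD('n::finite) \<ge> 3"
    and "1 \<le> m"
    and "m < CARD('n) - 1"
  shows "\<exists>E :: (real ^ 'n) set. closed E \<and> connected E \<and>
           weakly_m_convex_closed m E \<and> \<not> m_convex m E"
proof -
  obtain s :: "'n \<Rightarrow> 'n"
    where s: "\<forall>P. P \<noteq> {} \<longrightarrow> (\<forall>i. s i \<in> P \<longrightarrow> i \<in> P) \<longrightarrow> P = UNIV"
    using ex_cyclic_shift by blast
  \<comment> \<open>If \<open>i\<close> were fixed by \<open>s\<close>, the complement of
    \<open>{i}\<close> would be closed under backward steps. It is nonempty, so it would have to be
    everything.\<close>
  have "s i \<noteq> i" for i
  proof
    assume "s i = i"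
    moreover have "- {i} \<noteq> {}"
    proof
      assume "- {i} = {}"
      then have "UNIV = {i}" by auto
      then have "CARD('n) = card {i}" by (rule arg_cong)
      then show False using assms(1) by simp
    qed
    ultimately have "- {i} = UNIV" by (intro s[rule_format]) auto
    then show False by blast
  qed
  then have "connected (slab_set s)" by (rule connected_slab_set[OF s])
  moreover have "m \<le> CARD('n) - 2" using assms(3) by linarith
  ultimately show ?thesis
    by (intro exI[of _ "slab_set s"] conjI closed_slab_set weakly_m_convex_closed_slab_set
        not_m_convex_slab_set assms(2))
qed

end
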